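(* Let $\Bbbk$ be a field, $e\ge3$, $I=\mathbb Z/e\mathbb Z=\{0,\dots,e-1\}$, $k\in I$, $\ell\ge1$, $\boldsymbol\kappa\in I^\ell$, $\alpha\in Q^+$, and let $\boldsymbol\lambda\in\mathscr P^{\boldsymbol\kappa}_\alpha$ be a $k$-horizontal $\ell$-partition. Then, in the balanced KLR algebra $S_{\overline\alpha}=\mathbf e R_{\overline\alpha}\mathbf e/\mathbf e\mathfrak J\mathbf e$, the subdivision isomorphism $\Phi_k:R_\alpha\to S_{\overline\alpha}$ satisfies $$\Phi_k(e_{\boldsymbol\lambda})=e_{\Phi_k(\boldsymbol\lambda)}+\mathbf e\mathfrak J\mathbf e .$$
   Context: **Combinatorics.** $Q^+=\bigoplus_{i\in I}\mathbb Z_{\ge0}\alpha_i$; the height of $\alpha$ is the sum of its coefficients; $I^\alpha$ is the set of words $\mathbf i=(i_1,\dots,i_n)$ in $I$ with $\sum_j\alpha_{i_j}=\alpha$. A node $(m,r,c)$ (component, row, column) of an $\ell$-partition has residue $\kappa_m+c-r\bmod e$; $\mathscr P^{\boldsymbol\kappa}_\alpha$ is the set of $\ell$-partitions $\boldsymbol\lambda$ with $\sum_{A\in[\boldsymbol\lambda]}\alpha_{\operatorname{res}A}=\alpha$. The initial tableau $T^{\boldsymbol\lambda}$ fills $[\boldsymbol\lambda]$ with $1,\dots,n$ along rows from left to right, rows from top to bottom, components from first to last; $\mathbf i^{\boldsymbol\lambda}$ is its residue sequence (the $t$-th entry is the residue of the node containing $t$), and $e_{\boldsymbol\lambda}:=e(\mathbf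 i^{\boldsymbol\lambda})$. $\boldsymbol\lambda$ is $k$-horizontal if in no component $m$ there is $r$ with $(m,r,1),(m,r+1,1)\in[\boldsymbol\lambda]$ and $\operatorname{res}(m,r,1)\equiv k+1\pmod e$. For $k$-horizontal $\boldsymbol\lambda$, $\Phi_k(\boldsymbol\lambda)$ is obtained by inserting a node immediately to the right of every $k$-node (node of residue $k$): $\Phi_k(\boldsymbol\lambda)^{(m)}_r=\boldsymbol\lambda^{(m)}_r+\#\{k\text{-nodes in row }r\text{ of component }m\}$. Its residues are taken modulo $e+1$ with charge $\overline{\boldsymbol\kappa}$, $\overline\kappa_m=\kappa_m$ if $\kappa_m\le k$, $\overline\kappa_m=\kappa_m+1$ if $\kappa_m>k$. **KLR algebras.** The cyclic quivers are oriented by $i\to i+1$. For $N\in\{e,e+1\}$, $J=\mathbb Z/N\mathbb Z$ and $\beta$ of height $n$ in the corresponding positive root lattice, $R_\beta$ is the unital $\Bbbk$-algebra generated by $e(\mathbf i)$ ($\mathbf i\in J^\beta$), $y_1,\dots,y_n$, $\psi_1,\dots,\psi_{n-1}$ with relations: $e(\mathbf i)e(\mathbf j)=\delta_{\mathbf i\mathbf j}e(\mathbf i)$, $\sum e(\mathbf i)=1$; $y_re(\mathbf i)=e(\mathbf i)y_r$, $\psi_re(\mathbf i)=e(\sigma_r\mathbf i)\psi_r$ ($\sigma_r$ swaps places $r,r+1$); $y_ry_s=y_sy_r$; $\psi_ry_s=y_s\psi_r$ if $s\ne r,r+1$; $\psi_r\psi_s=\psi_s\psi_r$ if $|r-s|>1$;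 $\psi_ry_{r+1}e(\mathbf i)=(y_r\psi_r+\delta_{i_r,i_{r+1}})e(\mathbf i)$, $y_{r+1}\psi_re(\mathbf i)=(\psi_ry_r+\delta_{i_r,i_{r+1}})e(\mathbf i)$; $\psi_r^2e(\mathbf i)=0$ if $i_r=i_{r+1}$, $=e(\mathbf i)$ if $i_{r+1}\ne i_r,i_r\pm1$, $=(y_{r+1}-y_r)e(\mathbf i)$ if $i_{r+1}=i_r+1$, $=(y_r-y_{r+1})e(\mathbf i)$ if $i_{r+1}=i_r-1$; $(\psi_r\psi_{r+1}\psi_r-\psi_{r+1}\psi_r\psi_{r+1})e(\mathbf i)=e(\mathbf i)$ if $i_{r+2}=i_r$ and $i_{r+1}=i_r+1$, $=-e(\mathbf i)$ if $i_{r+2}=i_r$ and $i_{r+1}=i_r-1$, and $0$ otherwise. $R_\alpha$ is the case $N=e$; $R_{\overline\alpha}$ is the case $N=e+1$, with $\overline I=\mathbb Z/(e+1)\mathbb Z=\{0,\dots,e\}$. **Subdivision.** $\overline\alpha=\Phi_k(\alpha)$ is defined by linear extension of $\alpha_i\mapsto\alpha_i$ ($i<k$), $\alpha_k\mapsto\alpha_k+\alpha_{k+1}$, $\alpha_i\mapsto\alpha_{i+1}$ ($k<i\le e-1$). For $\mathbf i\in I^\alpha$, $\overline{\mathbf i}=\Phi_k(\mathbf i)\in\overline I^{\overline\alpha}$ is obtained by keeping letters $<k$, replacing letters $i>k$ by $i+1$, and replacing each letter $k$ by the two letters $k,k+1$. A word $\mathbf j\in\overline I^{\overline\alpha}$ is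 *ordered* if every occurrence of $k$ is immediately followed by $k+1$; it is *unordered* if some initial segment contains strictly more $(k+1)$'s than $k$'s. $\mathbf e=\sum_{\mathbf j\text{ ordered}}e(\mathbf j)$, $\mathfrak J=\sum_{\mathbf j\text{ unordered}}R_{\overline\alpha}e(\mathbf j)R_{\overline\alpha}$, $S_{\overline\alpha}=\mathbf eR_{\overline\alpha}\mathbf e/\mathbf e\mathfrak J\mathbf e$. The subdivision isomorphism (Maksimau) $\Phi_k:R_\alpha\to S_{\overline\alpha}$ is the graded algebra isomorphism induced by the following operation on the string diagrams of the basis elements $\psi_wy_1^{a_1}\cdots y_n^{a_n}e(\mathbf i)$: add, immediately to the right of each $k$-string, a parallel string without dots labelled $k+1$, and relabel the old labels $i>k$ by $i+1$. On generators, with $r'=r+\#\{j<r\mid i_j=k\}$ and modulo $\mathbf e\mathfrak J\mathbf e$, this reads $e(\mathbf i)\mapsto e(\overline{\mathbf i})$, $y_re(\mathbf i)\mapsto y_{r'}e(\overline{\mathbf i})$, and $\psi_re(\mathbf i)\mapsto\psi_{r'}e(\overline{\mathbf i})$ if $i_r,i_{r+1}\ne k$; $\psi_{r'}\psi_{r'+1}e(\overline{\mathbf i})$ if $i_r=k\neq i_{r+1}$; $\psi_{r'+1}\psi_{r'}e(\overline{\mathbf i})$ if $i_r\ne k=i_{r+1}$; $\psi_{r'+1}\psi_{r'+2}\psi_{r'}\psi_{r'+1}e(\overline{\mathbf i})$ if $i_r=i_{r+1}=k$.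
   Formalization: The stated image of ψ_r e(i) for i_r=i_{r+1}=k has the wrong sign outside characteristic 2 (for α=2α_k it would force 2e=0); the formal statement allows this image up to one global sign ±1, which covers both the printed and the corrected formula. *)

theory Defs
  imports "HOL-Library.Poly_Mapping" "HOL-Library.Multiset" "HOL-Algebra.QuotRing"
begin

text \<open>
  Conventions. \<open>\<int>/N\<int>\<close> is represented by \<open>{..<N}\<close>. An element \<open>\<Sum>c\<^sub>i \<alpha>\<^sub>i\<close> of the positive root
  lattice is the multiset in which \<open>i\<close> has multiplicity \<open>c\<^sub>i\<close>; its height is \<open>size\<close>. All places are
  counted from 0: the letters of a word are \<open>w ! 0, \<dots>, w ! (n - 1)\<close>, the generators of the KLR
  algebra are \<open>y\<^sub>0, \<dots>, y\<^sub>n\<^sub>-\<^sub>1\<close> and \<open>\<psi>\<^sub>0, \<dots>, \<psi>\<^sub>n\<^sub>-\<^sub>2\<close>, and components, rows and columns of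
  multipartitions start at 0 (residues only depend on the difference of column and row).
\<close>

section \<open>Multipartitions\<close>

definition is_partition :: "nat list \<Rightarrow> bool" where
  "is_partition p \<longleftrightarrow> sorted_wrt (\<ge>) p \<and> 0 \<notin> set p"

definition young_diagram :: "nat list list \<Rightarrow> (nat \<times> nat \<times> nat) set" where
  "young_diagram lam =
     {(m, r, c). m < length lam \<and> r < length (lam ! m) \<and> c < lam ! m ! r}"

definition node_res :: "nat \<Rightarrow> nat list \<Rightarrow> nat \<times> nat \<times> nat \<Rightarrow> nat" where
  "node_res N \<kappa> = (\<lambda>(m, r, c). nat ((int (\<kappa> ! m) + int c - int r) mod int N))"

definition multipartitions :: "nat \<Rightarrow> nat list \<Rightarrow> nat multiset \<Rightarrow> nat list list set" where
  "multipartitions N \<kappa> \<alpha> =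
     {lam. length lam = length \<kappa> \<and> (\<forall>p \<in> set lam. is_partition p) \<and>
           (\<Sum>A \<in> young_diagram lam. {#node_res N \<kappa> A#}) = \<alpha>}"

text \<open>The initial tableau, as the list whose entry at place \<open>t\<close> is the node containing \<open>t + 1\<close>.\<close>

definition initial_tableau :: "nat list list \<Rightarrow> (nat \<times> nat \<times> nat) list" where
  "initial_tableau lam =
     [(m, r, c). m \<leftarrow> [0..<length lam], r \<leftarrow> [0..<length (lam ! m)], c \<leftarrow> [0..<lam ! m ! r]]"

definition residue_word :: "nat \<Rightarrow> nat list \<Rightarrow> nat list list \<Rightarrow> nat list" where
  "residue_word N \<kappa> lam = map (node_res N \<kappa>) (initial_tableau lam)"

definition k_horizontal :: "nat \<Rightarrow> nat list \<Rightarrow> nat \<Rightarrow> nat list list \<Rightarrow> bool" where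
  "k_horizontal N \<kappa> k lam \<longleftrightarrow>
     \<not> (\<exists>m r. (m, r, 0) \<in> young_diagram lam \<and> (m, Suc r, 0) \<in> young_diagram lam \<and>
              node_res N \<kappa> (m, r, 0) = (k + 1) mod N)"


section \<open>Subdivision on charges, multipartitions, words and roots\<close>

definition subdiv_charge :: "nat \<Rightarrow> nat list \<Rightarrow> nat list" where
  "subdiv_charge k \<kappa> = map (\<lambda>i. if i \<le> k then i else i + 1) \<kappa>"

definition subdiv_multipartition ::
    "nat \<Rightarrow> nat list \<Rightarrow> nat \<Rightarrow> nat list list \<Rightarrow> nat list list" where
  "subdiv_multipartition N \<kappa> k lam =
     map (\<lambda>m. map (\<lambda>r. lam ! m ! r + card {c. c < lam ! m ! r \<and> node_res N \<kappa> (m, r, c) = k})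
                  [0..<length (lam ! m)])
         [0..<length lam]"

definition subdiv_letter :: "nat \<Rightarrow> nat \<Rightarrow> nat list" where
  "subdiv_letter k i = (if i < k then [i] else if i = k then [k, k + 1] else [i + 1])"

definition subdiv_word :: "nat \<Rightarrow> nat list \<Rightarrow> nat list" where
  "subdiv_word k w = concat (map (subdiv_letter k) w)"

text \<open>Linear extension of \<open>\<alpha>\<^sub>i \<mapsto> \<alpha>\<^sub>i\<close>, \<open>\<alpha>\<^sub>k \<mapsto> \<alpha>\<^sub>k + \<alpha>\<^sub>k\<^sub>+\<^sub>1\<close>, \<open>\<alpha>\<^sub>j \<mapsto> \<alpha>\<^sub>j\<^sub>+\<^sub>1\<close> for \<open>i < k < j\<close>.\<close>

definition subdiv_root :: "nat \<Rightarrow> nat multiset \<Rightarrow> nat multiset" where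
  "subdiv_root k \<alpha> = (\<Sum>i \<in># \<alpha>. mset (subdiv_letter k i))"

definition subdiv_place :: "nat \<Rightarrow> nat list \<Rightarrow> nat \<Rightarrow> nat" where
  "subdiv_place k w r = r + card {j. j < r \<and> w ! j = k}"


section \<open>Free associative algebras\<close>

text \<open>
  The free monoid is written additively, so that finitely supported functions on it carry the
  convolution product of the library: \<open>'g fmon \<Rightarrow>\<^sub>0 'k\<close> is the free associative
  \<open>'k\<close>-algebra on all of \<open>'g\<close>.
\<close>

datatype 'g fmon = FMon (letters: "'g list")

instantiation fmon :: (type) monoid_add
begin

definition zero_fmon :: "'a fmon" where "zero_fmon = FMon []"

definition plus_fmon :: "'a fmon \<Rightarrow> 'a fmon \<Rightarrow> 'a fmon" where
  "plus_fmon v w = FMon (letters v @ letters w)"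

instance by standard (auto simp: zero_fmon_def plus_fmon_def)

end

definition free_gen :: "'g \<Rightarrow> 'g fmon \<Rightarrow>\<^sub>0 'k::field" where
  "free_gen g = Poly_Mapping.single (FMon [g]) 1"

definition free_scalar :: "'k \<Rightarrow> 'g fmon \<Rightarrow>\<^sub>0 'k::field" where
  "free_scalar c = Poly_Mapping.single 0 c"

definition free_algebra :: "'g set \<Rightarrow> ('g fmon \<Rightarrow>\<^sub>0 'k::field) ring" where
  "free_algebra X =
     \<lparr>carrier = {p. \<forall>v \<in> Poly_Mapping.keys p. set (letters v) \<subseteq> X},
      mult = (*), one = 1, zero = 0, add = (+)\<rparr>"


section \<open>KLR algebras of cyclic quivers\<close>

definition words :: "nat \<Rightarrow> nat multiset \<Rightarrow> nat list set" where
  "words N \<beta> = {w. set w \<subseteq> {..<N} \<and> (\<Sum>i \<leftarrow> w. {#i#}) = \<beta>}"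

definition swap_at :: "nat \<Rightarrow> 'a list \<Rightarrow> 'a list" where
  "swap_at r w = w[r := w ! Suc r, Suc r := w ! r]"

datatype klr_gen = Gen_e "nat list" | Gen_y nat | Gen_psi nat

type_synonym 'k klr_free = "klr_gen fmon \<Rightarrow>\<^sub>0 'k"

abbreviation fe :: "nat list \<Rightarrow> 'k::field klr_free" where "fe w \<equiv> free_gen (Gen_e w)"
abbreviation fy :: "nat \<Rightarrow> 'k::field klr_free" where "fy r \<equiv> free_gen (Gen_y r)"
abbreviation fpsi :: "nat \<Rightarrow> 'k::field klr_free" where "fpsi r \<equiv> free_gen (Gen_psi r)"

definition klr_gens :: "nat \<Rightarrow> nat multiset \<Rightarrow> klr_gen set" where
  "klr_gens N \<beta> = Gen_e ` words N \<beta> \<union> Gen_y ` {r. r < size \<beta>} \<union> Gen_psi ` {r. Suc r < size \<beta>}"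

inductive_set klr_relations :: "nat \<Rightarrow> nat multiset \<Rightarrow> 'k::field klr_free set"
  for N :: nat and \<beta> :: "nat multiset" where
  e_orth: "\<lbrakk>v \<in> words N \<beta>; w \<in> words N \<beta>\<rbrakk> \<Longrightarrow>
     fe v * fe w - (if v = w then fe v else 0) \<in> klr_relations N \<beta>"
| e_sum: "(\<Sum>w \<in> words N \<beta>. fe w) - 1 \<in> klr_relations N \<beta>"
| y_e: "\<lbrakk>r < size \<beta>; w \<in> words N \<beta>\<rbrakk> \<Longrightarrow>
     fy r * fe w - fe w * fy r \<in> klr_relations N \<beta>"
| psi_e: "\<lbrakk>Suc r < size \<beta>; w \<in> words N \<beta>\<rbrakk> \<Longrightarrow>
     fpsi r * fe w - fe (swap_at r w) * fpsi r \<in> klr_relations N \<beta>"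
| y_y: "\<lbrakk>r < size \<beta>; s < size \<beta>\<rbrakk> \<Longrightarrow>
     fy r * fy s - fy s * fy r \<in> klr_relations N \<beta>"
| psi_y_far: "\<lbrakk>Suc r < size \<beta>; s < size \<beta>; s \<noteq> r; s \<noteq> Suc r\<rbrakk> \<Longrightarrow>
     fpsi r * fy s - fy s * fpsi r \<in> klr_relations N \<beta>"
| psi_psi_far: "\<lbrakk>Suc r < size \<beta>; Suc s < size \<beta>; Suc r < s \<or> Suc s < r\<rbrakk> \<Longrightarrow>
     fpsi r * fpsi s - fpsi s * fpsi r \<in> klr_relations N \<beta>"
| psi_y: "\<lbrakk>Suc r < size \<beta>; w \<in> words N \<beta>\<rbrakk> \<Longrightarrow>
     fpsi r * fy (Suc r) * fe w
       - (fy r * fpsi r + (if w ! r = w ! Suc r then 1 else 0)) * fe w \<in> klr_relations N \<beta>"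
| y_psi: "\<lbrakk>Suc r < size \<beta>; w \<in> words N \<beta>\<rbrakk> \<Longrightarrow>
     fy (Suc r) * fpsi r * fe w
       - (fpsi r * fy r + (if w ! r = w ! Suc r then 1 else 0)) * fe w \<in> klr_relations N \<beta>"
| psi_sq: "\<lbrakk>Suc r < size \<beta>; w \<in> words N \<beta>\<rbrakk> \<Longrightarrow>
     fpsi r * fpsi r * fe w
       - (if w ! r = w ! Suc r then 0
          else if w ! Suc r = (w ! r + 1) mod N then (fy (Suc r) - fy r) * fe w
          else if w ! r = (w ! Suc r + 1) mod N then (fy r - fy (Suc r)) * fe w
          else fe w) \<in> klr_relations N \<beta>"
| braid: "\<lbrakk>Suc (Suc r) < size \<beta>; w \<in> words N \<beta>\<rbrakk> \<Longrightarrow>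
     (fpsi r * fpsi (Suc r) * fpsi r - fpsi (Suc r) * fpsi r * fpsi (Suc r)) * fe w
       - (if w ! Suc (Suc r) = w ! r \<and> w ! Suc r = (w ! r + 1) mod N then fe w
          else if w ! Suc (Suc r) = w ! r \<and> w ! r = (w ! Suc r + 1) mod N then - fe w
          else 0) \<in> klr_relations N \<beta>"

definition klr_ideal :: "nat \<Rightarrow> nat multiset \<Rightarrow> 'k::field klr_free set" where
  "klr_ideal N \<beta> = Idl\<^bsub>free_algebra (klr_gens N \<beta>)\<^esub> (klr_relations N \<beta>)"

definition klr :: "nat \<Rightarrow> nat multiset \<Rightarrow> 'k::field klr_free set ring" where
  "klr N \<beta> = free_algebra (klr_gens N \<beta>) Quot klr_ideal N \<beta>"

definition klr_class :: "nat \<Rightarrow> nat multiset \<Rightarrow> 'k::field klr_free \<Rightarrow> 'k klr_free set" where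
  "klr_class N \<beta> p = klr_ideal N \<beta> +>\<^bsub>free_algebra (klr_gens N \<beta>)\<^esub> p"


section \<open>Balanced KLR algebras\<close>

definition ordered :: "nat \<Rightarrow> nat list \<Rightarrow> bool" where
  "ordered k w \<longleftrightarrow> (\<forall>t < length w. w ! t = k \<longrightarrow> Suc t < length w \<and> w ! Suc t = k + 1)"

definition unordered :: "nat \<Rightarrow> nat list \<Rightarrow> bool" where
  "unordered k w \<longleftrightarrow>
     (\<exists>t \<le> length w. count_list (take t w) (k + 1) > count_list (take t w) k)"

definition corner_ring :: "('a, 'm) ring_scheme \<Rightarrow> 'a \<Rightarrow> 'a ring" where
  "corner_ring R f =
     \<lparr>carrier = {f \<otimes>\<^bsub>R\<^esub> x \<otimes>\<^bsub>R\<^esub> f |x. x \<in> carrier R},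
      mult = mult R, one = f, zero = \<zero>\<^bsub>R\<^esub>, add = add R\<rparr>"

text \<open>
  In the following definitions \<open>N\<close> and \<open>\<beta>\<close> are the parameters of the ambient KLR algebra; they will
  be \<open>e + 1\<close> and \<open>subdiv_root k \<alpha>\<close>.
\<close>

definition ord_idem :: "nat \<Rightarrow> nat \<Rightarrow> nat multiset \<Rightarrow> 'k::field klr_free set" where
  "ord_idem k N \<beta> = klr_class N \<beta> (\<Sum>w \<in> {w \<in> words N \<beta>. ordered k w}. fe w)"

definition unord_ideal :: "nat \<Rightarrow> nat \<Rightarrow> nat multiset \<Rightarrow> 'k::field klr_free set set" where
  "unord_ideal k N \<beta> =
     Idl\<^bsub>klr N \<beta>\<^esub> {klr_class N \<beta> (fe w) |w. w \<in> words N \<beta> \<and> unordered k w}"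

definition balanced_corner :: "nat \<Rightarrow> nat \<Rightarrow> nat multiset \<Rightarrow> 'k::field klr_free set ring" where
  "balanced_corner k N \<beta> = corner_ring (klr N \<beta>) (ord_idem k N \<beta>)"

definition balanced_ideal :: "nat \<Rightarrow> nat \<Rightarrow> nat multiset \<Rightarrow> 'k::field klr_free set set" where
  "balanced_ideal k N \<beta> =
     {ord_idem k N \<beta> \<otimes>\<^bsub>klr N \<beta>\<^esub> x \<otimes>\<^bsub>klr N \<beta>\<^esub> ord_idem k N \<beta> |x. x \<in> unord_ideal k N \<beta>}"

definition balanced_klr :: "nat \<Rightarrow> nat \<Rightarrow> nat multiset \<Rightarrow> 'k::field klr_free set set ring" where
  "balanced_klr k N \<beta> = balanced_corner k N \<beta> Quot balanced_ideal k N \<beta>"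

definition balanced_class ::
    "nat \<Rightarrow> nat \<Rightarrow> nat multiset \<Rightarrow> 'k::field klr_free set \<Rightarrow> 'k klr_free set set" where
  "balanced_class k N \<beta> x = balanced_ideal k N \<beta> +>\<^bsub>balanced_corner k N \<beta>\<^esub> x"


section \<open>The subdivision isomorphism\<close>

text \<open>
  The image of the crossing of strands \<open>r\<close> and \<open>r + 1\<close> of \<open>w\<close>, as an element of the free algebra.

  The parameter \<open>\<epsilon>\<close> will be \<open>1\<close> or \<open>- 1\<close>. For \<open>\<psi> = \<psi>\<^sub>1 \<psi>\<^sub>2 \<psi>\<^sub>0 \<psi>\<^sub>1\<close> and
  \<open>w = [k, k + 1, k, k + 1]\<close> the relations give \<open>\<psi> y\<^sub>2 e(w) = (y\<^sub>0 \<psi> - 1) e(w)\<close> modulo the ideal of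
  unordered words, so outside characteristic 2 only \<open>\<epsilon> = - 1\<close> is compatible with
  \<open>\<psi>\<^sub>0 y\<^sub>1 e([k, k]) = (y\<^sub>0 \<psi>\<^sub>0 + 1) e([k, k])\<close>. Replacing strands in string diagrams without
  tracking signs gives \<open>\<epsilon> = 1\<close>. Both values are admitted.
\<close>

definition subdiv_crossing :: "'k::field \<Rightarrow> nat \<Rightarrow> nat list \<Rightarrow> nat \<Rightarrow> 'k klr_free" where
  "subdiv_crossing \<epsilon> k w r =
     (let q = subdiv_place k w r; f = fe (subdiv_word k w) in
      if w ! r \<noteq> k \<and> w ! Suc r \<noteq> k then fpsi q * f
      else if w ! Suc r \<noteq> k then fpsi q * fpsi (q + 1) * f
      else if w ! r \<noteq> k then fpsi (q + 1) * fpsi q * f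
      else free_scalar \<epsilon> * fpsi (q + 1) * fpsi (q + 2) * fpsi q * fpsi (q + 1) * f)"

text \<open>
  \<open>is_subdivision_iso e k \<alpha> \<Phi>\<close>: the map \<open>\<Phi>\<close> is an isomorphism of \<open>'k\<close>-algebras given by the
  subdivision formulas on the generators. There is at most one such map for each sign, and it
  preserves degrees because the formulas do. Scalars act through their images in the algebras.
\<close>

definition is_subdivision_iso ::
    "nat \<Rightarrow> nat \<Rightarrow> nat multiset \<Rightarrow> ('k::field klr_free set \<Rightarrow> 'k klr_free set set) \<Rightarrow> bool" where
  "is_subdivision_iso e k \<alpha> \<Phi> \<longleftrightarrow>
     (let N = e + 1; \<beta> = subdiv_root k \<alpha>; n = size \<alpha>;
          S = balanced_klr k N \<beta>;
          cls = (\<lambda>p. balanced_class k N \<beta> (klr_class N \<beta> p))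
      in \<Phi> \<in> ring_iso (klr e \<alpha>) S \<and>
         (\<forall>a. \<forall>x \<in> carrier (klr e \<alpha>).
            \<Phi> (klr_class e \<alpha> (free_scalar a) \<otimes>\<^bsub>klr e \<alpha>\<^esub> x) =
            balanced_class k N \<beta>
              (klr_class N \<beta> (free_scalar a) \<otimes>\<^bsub>klr N \<beta>\<^esub> ord_idem k N \<beta>) \<otimes>\<^bsub>S\<^esub> \<Phi> x) \<and>
         (\<forall>w \<in> words e \<alpha>. \<Phi> (klr_class e \<alpha> (fe w)) = cls (fe (subdiv_word k w))) \<and>
         (\<forall>w \<in> words e \<alpha>. \<forall>r < n.
            \<Phi> (klr_class e \<alpha> (fy r * fe w)) =
            cls (fy (subdiv_place k w r) * fe (subdiv_word k w))) \<and>
         (\<exists>\<epsilon> \<in> {1, - 1}. \<forall>w \<in> words e \<alpha>. \<forall>r. Suc r < n \<longrightarrow>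
            \<Phi> (klr_class e \<alpha> (fpsi r * fe w)) = cls (subdiv_crossing \<epsilon> k w r)))"

text \<open>The idempotent attached to a multipartition.\<close>

definition e_lam ::
    "nat \<Rightarrow> nat list \<Rightarrow> nat multiset \<Rightarrow> nat list list \<Rightarrow> 'k::field klr_free set" where
  "e_lam N \<kappa> \<beta> lam = klr_class N \<beta> (fe (residue_word N \<kappa> lam))"

end

theory Submission
  imports Defs
begin

text \<open>
  Let \<open>\<phi>\<close> send a residue \<open>i\<close> modulo \<open>e\<close> to the first letter of its subdivision. Modulo \<open>e + 1\<close>
  we have \<open>\<phi>(i + 1) = \<phi>(i) + 1\<close>, except that \<open>\<phi>(k + 1) = \<phi>(k) + 2\<close>. The exception is what the
  extra node after each \<open>k\<close>-node accounts for along a row; down the first column it would occur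
  exactly below a node of residue \<open>k + 1\<close>, which being \<open>k\<close>-horizontal excludes. Hence
  \<open>\<Phi>\<^sub>k\<close> maps the residue word of \<open>\<lambda>\<close> to that of \<open>\<Phi>\<^sub>k(\<lambda>)\<close>, even before passing to the quotient.
\<close>

text \<open>This is \<phi> of the overview; the same function acts entrywise in
  \<open>subdiv_charge\<close>.\<close>

definition subdiv_res :: "nat \<Rightarrow> nat \<Rightarrow> nat" where
  "subdiv_res k i = (if i \<le> k then i else i + 1)"

text \<open>The only residue modulo \<open>e + 1\<close> that \<open>subdiv_res k\<close> misses is
  \<open>k + 1\<close>, so just the step from \<open>k\<close> has length 2. For
  \<open>k = e - 1\<close> that step is also the wrap-around to 0.\<close>

lemma subdiv_res_Suc:
  assumes "k < e" and "i < e"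
  shows "subdiv_res k (Suc i mod e) = (subdiv_res k i + (if i = k then 2 else 1)) mod (e + 1)"
proof (cases "Suc i = e")
  case True
  then show ?thesis using assms by (auto simp: subdiv_res_def)
next
  case False
  with assms have "Suc i < e" by simp
  then show ?thesis by (auto simp: subdiv_res_def)
qed

text \<open>The reduction modulo \<open>e + 1\<close> is vacuous here; this form presents a
  subdivided letter as a run of consecutive residues, ready to be joined to its neighbours in a
  row.\<close>

lemma subdiv_letter_eq:
  assumes "i < e"
  shows "subdiv_letter k i =
    map (\<lambda>c. (subdiv_res k i + c) mod (e + 1)) [0..<if i = k then 2 else 1]"
  using assms by (auto simp: subdiv_letter_def subdiv_res_def numeral_2_eq_2)

text \<open>Here \<open>len n\<close> is the length of the subdivided row. The second conjunct
  carries the induction: the run produced so far ends just where the next letter's run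
  starts.\<close>

lemma concat_subdiv_letter_row:
  assumes "k < e" and "a < e"
  defines "len \<equiv> \<lambda>n. n + card {c. c < n \<and> (a + c) mod e = k}"
  shows "concat (map (\<lambda>c. subdiv_letter k ((a + c) mod e)) [0..<n]) =
      map (\<lambda>c. (subdiv_res k a + c) mod (e + 1)) [0..<len n] \<and>
    (subdiv_res k a + len n) mod (e + 1) = subdiv_res k ((a + n) mod e)"
proof (induction n)
  case 0
  show ?case using assms by (auto simp: subdiv_res_def len_def)
next
  case (Suc n)
  let ?i = "(a + n) mod e"
  let ?d = "if ?i = k then 2 else 1 :: nat"
  have i: "?i < e" using assms by simp
  have "{c. c < Suc n \<and> (a + c) mod e = k} =
      (if ?i = k then insert n else id) {c. c < n \<and> (a + c) mod e = k}"
    by (auto simp: less_Suc_eq)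
  then have len: "len (Suc n) = len n + ?d"
    by (simp add: len_def)
  have upt: "[0..<Suc n] = [0..<n] @ [n]"
    by simp
  have split: "[0..<len n + ?d] = [0..<len n] @ map (\<lambda>c. c + len n) [0..<?d]"
    by (simp only: upt_add_eq_append[OF le0, of "len n" ?d] map_add_upt add.commute[of ?d])
  \<comment> \<open>By the second conjunct of the induction hypothesis, the run for
    \<open>?i\<close> starts at column \<open>len n\<close> of the new row.\<close>
  have "subdiv_letter k ?i = map (\<lambda>c. (subdiv_res k a + (len n + c)) mod (e + 1)) [0..<?d]"
    unfolding subdiv_letter_eq[OF i] Suc.IH[THEN conjunct2, symmetric]
    by (simp only: mod_add_left_eq add.assoc)
  moreover have "(subdiv_res k a + len (Suc n)) mod (e + 1) = subdiv_res k ((a + Suc n) mod e)"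
  proof -
    have "(subdiv_res k a + len (Suc n)) mod (e + 1) = (subdiv_res k ?i + ?d) mod (e + 1)"
      unfolding Suc.IH[THEN conjunct2, symmetric] len by (simp only: mod_add_left_eq add.assoc)
    also have "\<dots> = subdiv_res k (Suc ?i mod e)"
      using subdiv_res_Suc[OF \<open>k < e\<close> i] by simp
    finally show ?thesis by (simp add: mod_Suc_eq)
  qed
  ultimately show ?case using Suc.IH by (simp add: len split upt o_def ac_simps del: upt_Suc)
qed

lemma node_res_less: "0 < N \<Longrightarrow> node_res N \<kappa> A < N"
  by (auto simp: node_res_def nat_less_iff split: prod.split)

lemma node_res_column:
  assumes "0 < N"
  shows "node_res N \<kappa> (m, r, c) = (node_res N \<kappa> (m, r, 0) + c) mod N"
proof -
  have "int (node_res N \<kappa> (m, r, c)) = int ((node_res N \<kappa> (m, r, 0) + c) mod N)"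
    using assms by (simp add: node_res_def zmod_int mod_simps algebra_simps)
  then show ?thesis by (simp only: of_nat_eq_iff)
qed

lemma node_res_row_Suc:
  assumes "0 < N"
  shows "Suc (node_res N \<kappa> (m, Suc r, 0)) mod N = node_res N \<kappa> (m, r, 0)"
proof -
  have "int (Suc (node_res N \<kappa> (m, Suc r, 0)) mod N) = int (node_res N \<kappa> (m, r, 0))"
    using assms by (simp add: node_res_def zmod_int mod_simps)
  then show ?thesis by (simp only: of_nat_eq_iff)
qed

text \<open>One row down lowers both residues by 1, and \<open>subdiv_res k\<close> respects this
  unless the lower residue is \<open>k\<close>, that is, the upper one is
  \<open>k + 1\<close>.\<close>

lemma node_res_subdiv_charge:
  assumes "k < e" and "m < length \<kappa>" and "set \<kappa> \<subseteq> {..<e}"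
    and "\<And>r'. r' < r \<Longrightarrow> node_res e \<kappa> (m, r', 0) \<noteq> (k + 1) mod e"
  shows "node_res (e + 1) (subdiv_charge k \<kappa>) (m, r, 0) = subdiv_res k (node_res e \<kappa> (m, r, 0))"
  using assms(4)
proof (induction r)
  case 0
  have "\<kappa> ! m < e" using assms nth_mem by blast
  then show ?case using assms(2)
    by (simp add: node_res_def subdiv_charge_def subdiv_res_def flip: zmod_int)
next
  case (Suc r)
  let ?x = "node_res (e + 1) (subdiv_charge k \<kappa>) (m, Suc r, 0)"
  let ?i = "node_res e \<kappa> (m, Suc r, 0)"
  have i: "?i < e" using assms(1) by (intro node_res_less) simp
  have "?i \<noteq> k" using Suc.prems[of r] node_res_row_Suc[of e \<kappa> m r] assms(1) by auto
  have "Suc ?x mod (e + 1) = subdiv_res k (Suc ?i mod e)"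
    using Suc.IH Suc.prems node_res_row_Suc assms(1) by simp
  also have "\<dots> = Suc (subdiv_res k ?i) mod (e + 1)"
    using subdiv_res_Suc[OF assms(1) i] \<open>?i \<noteq> k\<close> by simp
  finally have "Suc ?x mod (e + 1) = Suc (subdiv_res k ?i) mod (e + 1)" .
  moreover have "?x < e + 1" by (intro node_res_less) simp
  moreover have "subdiv_res k ?i < e + 1" using i by (simp add: subdiv_res_def)
  \<comment> \<open>The successor modulo \<open>e + 1\<close> is injective on residues below
    \<open>e + 1\<close>, so it cancels.\<close>
  ultimately show ?case by (auto simp: mod_Suc split: if_splits)
qed

lemma concat_concat_eq: "concat (concat xss) = concat (map concat xss)"
  by (induction xss) auto

lemma distinct_concat_map:
  assumes "distinct xs" and "\<And>x. x \<in> set xs \<Longrightarrow> distinct (f x)"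
    and "\<And>x y. x \<in> set xs \<Longrightarrow> y \<in> set xs \<Longrightarrow> x \<noteq> y \<Longrightarrow> set (f x) \<inter> set (f y) = {}"
  shows "distinct (concat (map f xs))"
  using assms
proof (induction xs)
  case (Cons x xs)
  then have "set (f x) \<inter> set (f y) = {}" if "y \<in> set xs" for y
    using that by (metis distinct.simps(2) list.set_intros)
  with Cons show ?case by auto
qed simp

lemma distinct_initial_tableau: "distinct (initial_tableau lam)"
  unfolding initial_tableau_def
  by (intro distinct_concat_map) (auto simp: distinct_map inj_on_def)

lemma set_initial_tableau: "set (initial_tableau lam) = young_diagram lam"
  unfolding initial_tableau_def young_diagram_def by force

text \<open>The content is a sum along a list for words but over a set for multipartitions; they
  agree because the tableau lists each node once.\<close>

lemma residue_word_in_words: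
  assumes "0 < N" and "lam \<in> multipartitions N \<kappa> \<alpha>"
  shows "residue_word N \<kappa> lam \<in> words N \<alpha>"
proof -
  have "(\<Sum>i \<leftarrow> residue_word N \<kappa> lam. {#i#}) = (\<Sum>A \<in> young_diagram lam. {#node_res N \<kappa> A#})"
    unfolding residue_word_def map_map o_def set_initial_tableau[symmetric]
    by (rule sum_list_distinct_conv_sum_set[OF distinct_initial_tableau])
  moreover have "set (residue_word N \<kappa> lam) \<subseteq> {..<N}"
    using assms(1) by (auto simp: residue_word_def node_res_less)
  ultimately show ?thesis
    using assms(2) unfolding words_def multipartitions_def by blast
qed

text \<open>Both words are compared row by row: \<open>node_res_subdiv_charge\<close> matches the
  first node of a row, \<open>concat_subdiv_letter_row\<close> the rest.\<close>

lemma subdiv_residue_word: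
  assumes "k < e" and "set \<kappa> \<subseteq> {..<e}" and "length lam = length \<kappa>"
    and pos: "\<And>m. m < length lam \<Longrightarrow> 0 \<notin> set (lam ! m)"
    and "k_horizontal e \<kappa> k lam"
  shows "subdiv_word k (residue_word e \<kappa> lam) =
    residue_word (e + 1) (subdiv_charge k \<kappa>) (subdiv_multipartition e \<kappa> k lam)"
proof -
  let ?\<kappa> = "subdiv_charge k \<kappa>"
  let ?len = "\<lambda>m r. lam ! m ! r + card {c. c < lam ! m ! r \<and> node_res e \<kappa> (m, r, c) = k}"
  have row: "concat (map (\<lambda>c. subdiv_letter k (node_res e \<kappa> (m, r, c))) [0..<lam ! m ! r]) =
      map (\<lambda>c. node_res (e + 1) ?\<kappa> (m, r, c)) [0..<?len m r]"
    if m: "m < length lam" and r: "r < length (lam ! m)" for m r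
  proof -
    have "0 < e" using assms(1) by simp
    have "node_res e \<kappa> (m, r', 0) \<noteq> (k + 1) mod e" if "r' < r" for r'
    proof -
      \<comment> \<open>Parts are nonzero, so both rows really have a node in column 0 and
        \<open>k_horizontal\<close> applies to them.\<close>
      have "0 < lam ! m ! r'" "0 < lam ! m ! Suc r'"
        using that r pos[OF m] nth_mem[of r' "lam ! m"] nth_mem[of "Suc r'" "lam ! m"]
        by (metis gr0I less_trans, metis gr0I le_less_trans Suc_leI)
      then have "(m, r', 0) \<in> young_diagram lam" "(m, Suc r', 0) \<in> young_diagram lam"
        using that m r by (auto simp: young_diagram_def)
      then show ?thesis
        using assms(5) unfolding k_horizontal_def by blast
    qed
    then have "node_res (e + 1) ?\<kappa> (m, r, 0) = subdiv_res k (node_res e \<kappa> (m, r, 0))"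
      using assms m by (intro node_res_subdiv_charge) auto
    moreover define a where "a = node_res e \<kappa> (m, r, 0)"
    ultimately have "node_res (e + 1) ?\<kappa> (m, r, c) = (subdiv_res k a + c) mod (e + 1)"
      and "node_res e \<kappa> (m, r, c) = (a + c) mod e" for c
      using node_res_column[of "e + 1" ?\<kappa> m r c] node_res_column[OF \<open>0 < e\<close>, of \<kappa> m r c]
      by simp_all
    moreover have "a < e" using \<open>0 < e\<close> by (simp add: a_def node_res_less)
    ultimately show ?thesis
      using concat_subdiv_letter_row[OF assms(1)] by simp
  qed
  show ?thesis
    \<comment> \<open>Flattening the nested concatenations brings the subdivision inside each single
      row, where \<open>row\<close> applies.\<close>
    unfolding subdiv_word_def residue_word_def initial_tableau_def map_concat concat_concat_eq
      map_map o_def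
    by (auto simp: subdiv_multipartition_def row intro!: arg_cong[of _ _ concat])
qed

theorem theorem6p3:
  fixes e k L :: nat and \<kappa> :: "nat list" and \<alpha> :: "nat multiset"
    and lam :: "nat list list"
    and \<Phi> :: "'k::field klr_free set \<Rightarrow> 'k klr_free set set"
  assumes "e \<ge> 3" and "k < e" and "L \<ge> 1"
    and "length \<kappa> = L" and "set \<kappa> \<subseteq> {..<e}"
    and "set_mset \<alpha> \<subseteq> {..<e}"
    and "lam \<in> multipartitions e \<kappa> \<alpha>"
    and "k_horizontal e \<kappa> k lam"
    and "is_subdivision_iso e k \<alpha> \<Phi>"
  shows "\<Phi> (e_lam e \<kappa> \<alpha> lam) =
         balanced_class k (e + 1) (subdiv_root k \<alpha>)
           (e_lam (e + 1) (subdiv_charge k \<kappa>) (subdiv_root k \<alpha>)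
             (subdiv_multipartition e \<kappa> k lam))"
proof -
  have "0 < e" using assms(1) by simp
  have lam: "length lam = length \<kappa>" "\<And>m. m < length lam \<Longrightarrow> 0 \<notin> set (lam ! m)"
    using assms(7) by (auto simp: multipartitions_def is_partition_def)
  \<comment> \<open>The map is prescribed on the idempotents of words in
    \<open>words e \<alpha>\<close>, hence the membership of the residue word.\<close>
  have "\<Phi> (e_lam e \<kappa> \<alpha> lam) = balanced_class k (e + 1) (subdiv_root k \<alpha>)
      (klr_class (e + 1) (subdiv_root k \<alpha>) (fe (subdiv_word k (residue_word e \<kappa> lam))))"
    using assms(9) residue_word_in_words[OF \<open>0 < e\<close> assms(7)]
    by (simp add: is_subdivision_iso_def Let_def e_lam_def)
  then show ?thesis
    using subdiv_residue_word[OF assms(2,5) lam assms(8)] by (simp add: e_lam_def)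
qed

end
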